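(* Let $p$ be a prime number, let $K$ be a finite extension of $\mathbf{Q}_p$ and let $f=\sum_{j=0}^\infty a_jT^j$ be a power series with coefficients in $K$. Let $R=(\limsup_j |a_j|^{1/j})^{-1}$ be its radius of convergence. Assume that $0<R<\infty$ and that $f\in K\{R^{-1}T\}$, i.e. $|a_j|R^j\to 0$ when $j\to\infty$. For each integer $n\ge 0$, let $f_n=\sum_{j=0}^n a_jT^j$. Let $(n_k)_{k\ge 0}$ be an increasing sequence of integers such that $|a_{n_k}|^{1/n_k}\to 1/R$ when $k\to\infty$. Then, for every positive integer $d$, the number of irreducible factors in $K[T]$ of $f_{n_k}$ of degree $\le d$ is $\mathrm{o}(n_k)$ when $k\to\infty$; and the maximum degree of an irreducible factor in $K[T]$ of $f_{n_k}$ tends to infinity when $k\to\infty$.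
   Context: $|\cdot|$ is the absolute value on $K$ extending the $p$-adic absolute value of $\mathbf{Q}_p$. For a positive real number $R$, the (generalized) Tate algebra $K\{R^{-1}T\}$ is the subalgebra of $K[[T]]$ consisting of the power series $\sum a_jT^j$ such that $|a_j|R^j\to 0$. Irreducible factors are counted with multiplicity. *)

theory Defs
  imports
    "HOL-Analysis.Analysis"
    "HOL-Computational_Algebra.Computational_Algebra"
    "HOL-Library.Landau_Symbols"
begin

definition absolute_value :: "('a::field \<Rightarrow> real) \<Rightarrow> bool" where
  "absolute_value v \<longleftrightarrow>
     (\<forall>x. 0 \<le> v x) \<and> (\<forall>x. v x = 0 \<longleftrightarrow> x = 0) \<and>
     (\<forall>x y. v (x * y) = v x * v y) \<and> (\<forall>x y. v (x + y) \<le> v x + v y)"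

definition padic_valuation_rat :: "nat \<Rightarrow> rat \<Rightarrow> int" where
  "padic_valuation_rat p r =
     int (multiplicity (int p) (fst (quotient_of r))) -
     int (multiplicity (int p) (snd (quotient_of r)))"

definition padic_abs_rat :: "nat \<Rightarrow> rat \<Rightarrow> real" where
  "padic_abs_rat p r = (if r = 0 then 0 else real p powi (- padic_valuation_rat p r))"

definition is_subfield :: "'a::field set \<Rightarrow> bool" where
  "is_subfield F \<longleftrightarrow>
     0 \<in> F \<and> 1 \<in> F \<and> (\<forall>x\<in>F. \<forall>y\<in>F. x + y \<in> F \<and> x * y \<in> F) \<and>
     (\<forall>x\<in>F. - x \<in> F \<and> inverse x \<in> F)"

text \<open>
  The field of p-adic numbers is the completion of the rationals for the p-adic absolute value.
  Inside a valued field, a subfield \<open>F\<close> is a copy of it, with \<open>v\<close> restricting to the p-adic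
  absolute value on \<open>F\<close>, iff \<open>v\<close> is the p-adic absolute value on the rationals,
  the rationals are dense in \<open>F\<close>, and \<open>F\<close> is complete.
\<close>

definition is_padic_numbers :: "nat \<Rightarrow> ('a::field_char_0 \<Rightarrow> real) \<Rightarrow> 'a set \<Rightarrow> bool" where
  "is_padic_numbers p v F \<longleftrightarrow>
     is_subfield F \<and>
     (\<forall>r. v (of_rat r) = padic_abs_rat p r) \<and>
     (\<forall>x\<in>F. \<forall>\<epsilon>>0. \<exists>r. v (x - of_rat r) < \<epsilon>) \<and>
     (\<forall>X :: nat \<Rightarrow> 'a. range X \<subseteq> F \<longrightarrow>
        (\<forall>\<epsilon>>0. \<exists>N. \<forall>i\<ge>N. \<forall>j\<ge>N. v (X i - X j) < \<epsilon>) \<longrightarrow>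
        (\<exists>x\<in>F. (\<lambda>i. v (X i - x)) \<longlonglongrightarrow> 0))"

definition finite_over :: "'a::field set \<Rightarrow> bool" where
  "finite_over F \<longleftrightarrow>
     (\<exists>B. finite B \<and> (\<forall>x. \<exists>c. (\<forall>b\<in>B. c b \<in> F) \<and> x = (\<Sum>b\<in>B. c b * b)))"

text \<open>
  The field \<open>K\<close> is the whole type \<open>'a\<close>; \<open>v\<close> is its absolute value.
\<close>

definition finite_extension_padic :: "nat \<Rightarrow> ('a::field_char_0 \<Rightarrow> real) \<Rightarrow> bool" where
  "finite_extension_padic p v \<longleftrightarrow>
     absolute_value v \<and> (\<exists>F. is_padic_numbers p v F \<and> finite_over F)"

definition radius_of_convergence :: "('a::field \<Rightarrow> real) \<Rightarrow> 'a fps \<Rightarrow> ereal" where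
  "radius_of_convergence v f = inverse (limsup (\<lambda>j. ereal (root j (v (fps_nth f j)))))"

definition tate_algebra :: "('a::field \<Rightarrow> real) \<Rightarrow> real \<Rightarrow> 'a fps set" where
  "tate_algebra v R = {f. (\<lambda>j. v (fps_nth f j) * R ^ j) \<longlonglongrightarrow> 0}"

definition partial_sum_poly :: "'a::field fps \<Rightarrow> nat \<Rightarrow> 'a poly" where
  "partial_sum_poly f n = (\<Sum>j\<le>n. monom (fps_nth f j) j)"

text \<open>
  Irreducible factors are taken up to associates: each class is represented by its monic member.
  The definitions below are meaningful for nonzero \<open>g\<close> only (for the maximum: nonconstant \<open>g\<close>).
\<close>

definition irreducible_factors :: "'a::field poly \<Rightarrow> 'a poly set" where
  "irreducible_factors g = {q. irreducible q \<and> lead_coeff q = 1 \<and> q dvd g}"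

text \<open>
  This is \<^const>\<open>multiplicity\<close>, which the library provides for polynomials over a field
  only under an additional sort constraint on the coefficients.
\<close>

definition factor_multiplicity :: "'a::field poly \<Rightarrow> 'a poly \<Rightarrow> nat" where
  "factor_multiplicity q g = Max {m. q ^ m dvd g}"

definition count_irreducible_factors_le :: "'a::field poly \<Rightarrow> nat \<Rightarrow> nat" where
  "count_irreducible_factors_le g d =
     (\<Sum>q\<in>{q \<in> irreducible_factors g. degree q \<le> d}. factor_multiplicity q g)"

definition max_irreducible_factor_degree :: "'a::field poly \<Rightarrow> nat" where
  "max_irreducible_factor_degree g = Max (degree ` irreducible_factors g)"

end

theory Submission
  imports Defs
begin

text \<open>
  For a coefficient sequence \<open>c\<close> with \<open>|c\<^sub>i| R\<^sup>i\<close> tending to \<open>0\<close>, let \<open>s\<close> be the last index at which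
  \<open>|c\<^sub>i| R\<^sup>i\<close> is maximal (\<open>last_dominant\<close>). For a polynomial this index is its number of zeros of
  absolute value at most \<open>R\<close> in an algebraic closure, and the maximum is its Gauss norm of radius
  \<open>R\<close>. Gauss's lemma (\<open>last_dominant_mult\<close>) says that in a product the indices add and the Gauss
  norms multiply. For a monic polynomial \<open>q\<close>, call
  \<open>ln (|q\<^sub>s| R\<^sup>s / R\<^bsup>deg q\<^esup>) \<ge> 0\<close> the excess of \<open>q\<close>; it measures how far the zeros of \<open>q\<close> lie
  outside the disc of radius \<open>R\<close>.

  Since \<open>f\<close> belongs to the Tate algebra of radius \<open>R\<close>, it has a last dominant index \<open>N\<close>, and all
  \<open>f\<^sub>n\<close> with \<open>n \<ge> N\<close> share this index and the value there. Hence, over the monic irreducible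
  factors of \<open>f\<^sub>n\<close> with multiplicity, the indices sum to the constant \<open>N\<close> and the excesses to
  \<open>const - ln (|a\<^sub>n| R\<^sup>n)\<close>. Along the given subsequence \<open>ln (|a\<^sub>n| R\<^sup>n) = n ln (|a\<^sub>n|\<^bsup>1/n\<^esup> R)\<close>
  is \<open>o(n)\<close>, because \<open>|a\<^sub>n|\<^bsup>1/n\<^esup> R\<close> tends to \<open>1\<close>.

  A factor of degree at most \<open>d\<close> must contribute to one of these two sums. Either all its zeros lie
  in the closed disc, and it contributes its degree, at least \<open>1\<close>, to the first sum; or its excess
  is positive, and then it is at least some \<open>\<kappa> > 0\<close> depending only on \<open>d\<close>
  (\<open>excess_bounded_below\<close>). This gap exists because the absolute value of a finite extension of the
  p-adic numbers is discrete: a fixed power of every value is a power of \<open>p\<close>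
  (\<open>finite_extension_value_group\<close>). So the number of such factors is at most
  \<open>N + o(n) / \<kappa>\<close> (\<open>count_irreducible_factors_le_bound\<close>), which is \<open>o(n)\<close>.

  If all irreducible factors of \<open>f\<^sub>n\<close> had degree at most \<open>D\<close>, there would be at least \<open>n / D\<close> of
  them, which contradicts this bound for large \<open>n\<close>; so the maximal degree tends to infinity.
\<close>

section \<open>Factorization of polynomials over a field into monic irreducibles\<close>

lemma monic_irreducible_factorization_exists:
  fixes g :: "'a::field poly"
  assumes "g \<noteq> 0"
  shows "\<exists>M c. (\<forall>q\<in>#M. irreducible q \<and> lead_coeff q = 1) \<and> c \<noteq> 0 \<and> g = smult c (\<Prod>\<^sub># M)"
  using assms
proof (induction "degree g" arbitrary: g rule: less_induct)
  case less
  consider (unit) "degree g = 0" | (irred) "irreducible g" | (red) "degree g \<noteq> 0" "\<not> irreducible g"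
    by blast
  then show ?case
  proof cases
    case unit
    then obtain c where "g = [:c:]" by (rule degree_eq_zeroE)
    with less.prems show ?thesis by (intro exI[of _ "{#}"] exI[of _ c]) simp
  next
    case irred
    let ?c = "lead_coeff g"
    let ?q = "smult (inverse ?c) g"
    have c: "?c \<noteq> 0" using less.prems by simp
    then have "[:inverse ?c:] dvd 1" by (simp add: is_unit_pCons_iff)
    then have "irreducible ([:inverse ?c:] * g)"
      using irred by (subst irreducible_mult_unit_left) auto
    then have "irreducible ?q" by simp
    moreover have "lead_coeff ?q = 1" using c by simp
    moreover have "g = smult ?c (\<Prod>\<^sub># {#?q#})" using c by simp
    ultimately show ?thesis using c by (intro exI[of _ "{#?q#}"] exI[of _ ?c]) simp
  next
    case red
    then have "\<not> is_unit g" by (auto simp: is_unit_iff_degree less.prems)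
    with red(2) less.prems obtain a b where ab: "g = a * b" "\<not> is_unit a" "\<not> is_unit b"
      by (auto simp: irreducible_def)
    with less.prems have nz: "a \<noteq> 0" "b \<noteq> 0" by auto
    with ab have "degree a > 0" "degree b > 0" by (auto simp: is_unit_iff_degree)
    with nz ab(1) have deg: "degree a < degree g" "degree b < degree g"
      by (auto simp: degree_mult_eq)
    obtain A c where A: "\<forall>q\<in>#A. irreducible q \<and> lead_coeff q = 1" "c \<noteq> 0" "a = smult c (\<Prod>\<^sub># A)"
      using less.hyps[OF deg(1) nz(1)] by blast
    obtain B d where B: "\<forall>q\<in>#B. irreducible q \<and> lead_coeff q = 1" "d \<noteq> 0" "b = smult d (\<Prod>\<^sub># B)"
      using less.hyps[OF deg(2) nz(2)] by blast
    have "g = smult (c * d) (\<Prod>\<^sub># (A + B))"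
      unfolding ab(1) A(3) B(3) by (simp add: mult.commute)
    moreover have "\<forall>q\<in>#A + B. irreducible q \<and> lead_coeff q = 1" using A(1) B(1) by auto
    moreover have "c * d \<noteq> 0" using A(2) B(2) by simp
    ultimately show ?thesis by blast
  qed
qed

lemma monic_irreducible_dvd_imp_eq:
  fixes q r :: "'a::field poly"
  assumes "irreducible q" "lead_coeff q = 1" "irreducible r" "lead_coeff r = 1" "q dvd r"
  shows "q = r"
proof -
  from \<open>q dvd r\<close> obtain c where c: "r = q * c" by blast
  with assms(1,3) have "is_unit c" by (auto simp: irreducible_def)
  then obtain e where "c = [:e:]" by (auto elim: is_unit_polyE)
  moreover from this c have "lead_coeff r = lead_coeff q * e" by (simp only: lead_coeff_mult) simp
  ultimately have "c = 1" using assms(2,4) by simp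
  with c show ?thesis by simp
qed

text \<open>
  Unique factorization in the form needed here: a monic irreducible is prime, and the only element
  of the multiset that it can divide is itself. It identifies any monic factorization with the sets
  and multiplicities of the statement.
\<close>

lemma power_dvd_prod_mset_iff:
  fixes q :: "'a::field poly"
  assumes "irreducible q" "lead_coeff q = 1" "\<forall>r\<in>#M. irreducible r \<and> lead_coeff r = 1"
  shows "q ^ m dvd \<Prod>\<^sub># M \<longleftrightarrow> m \<le> count M q"
  using assms(3)
proof (induction M arbitrary: m)
  case empty
  have "\<not> is_unit q" using assms(1) by (simp add: irreducible_def)
  then show ?case by (auto simp: is_unit_power_iff)
next
  case (add r M)
  have prime: "prime_elem q" using assms(1) by (rule field_poly_irreducible_imp_prime)
  have q0: "q \<noteq> 0" using assms(1) by auto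
  show ?case
  proof (cases "r = q")
    case True
    show ?thesis
    proof (cases m)
      case (Suc k)
      have "q ^ m dvd q * \<Prod>\<^sub># M \<longleftrightarrow> q ^ k dvd \<Prod>\<^sub># M"
        unfolding Suc power_Suc using q0 by (rule dvd_times_left_cancel_iff)
      also have "\<dots> \<longleftrightarrow> k \<le> count M q" using add.prems by (intro add.IH) simp
      finally show ?thesis using True Suc by simp
    qed simp
  next
    case False
    then have "\<not> q dvd r"
      using monic_irreducible_dvd_imp_eq[OF assms(1,2)] add.prems by auto
    then have "q ^ m dvd r * \<Prod>\<^sub># M \<longleftrightarrow> q ^ m dvd \<Prod>\<^sub># M"
      using prime_power_dvd_multD[OF prime, of m r "\<Prod>\<^sub># M"]
      by (metis dvd_mult gr0I one_dvd power_0)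
    with False add show ?thesis by auto
  qed
qed

lemma irreducible_factors_eq_set_mset:
  fixes g :: "'a::field poly"
  assumes "\<forall>r\<in>#M. irreducible r \<and> lead_coeff r = 1" "c \<noteq> 0" "g = smult c (\<Prod>\<^sub># M)"
  shows "irreducible_factors g = set_mset M"
  using power_dvd_prod_mset_iff[OF _ _ assms(1), of _ 1] assms
  by (auto simp: irreducible_factors_def dvd_smult_iff)

lemma factor_multiplicity_eq_count:
  fixes g :: "'a::field poly"
  assumes "\<forall>r\<in>#M. irreducible r \<and> lead_coeff r = 1" "c \<noteq> 0" "g = smult c (\<Prod>\<^sub># M)" "q \<in># M"
  shows "factor_multiplicity q g = count M q"
proof -
  have *: "{m. q ^ m dvd g} = {..count M q}"
    using power_dvd_prod_mset_iff[OF _ _ assms(1), of q] assms by (auto simp: dvd_smult_iff)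
  show ?thesis unfolding factor_multiplicity_def * by (intro Max_eqI) auto
qed

lemma count_irreducible_factors_le_eq_size:
  fixes g :: "'a::field poly"
  assumes "\<forall>r\<in>#M. irreducible r \<and> lead_coeff r = 1" "c \<noteq> 0" "g = smult c (\<Prod>\<^sub># M)"
  shows "count_irreducible_factors_le g d = size {#q \<in># M. degree q \<le> d#}"
proof -
  have "count_irreducible_factors_le g d = (\<Sum>q\<in>{q \<in> set_mset M. degree q \<le> d}. count M q)"
    unfolding count_irreducible_factors_le_def irreducible_factors_eq_set_mset[OF assms]
    by (intro sum.cong) (auto simp: factor_multiplicity_eq_count[OF assms])
  also have "\<dots> = size {#q \<in># M. degree q \<le> d#}"
    by (auto simp: size_multiset_overloaded_eq intro!: sum.cong)
  finally show ?thesis .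
qed

lemma degree_prod_mset_monic:
  fixes M :: "'a::field poly multiset"
  assumes "\<forall>r\<in>#M. lead_coeff r = 1"
  shows "lead_coeff (\<Prod>\<^sub># M) = 1" "degree (\<Prod>\<^sub># M) = (\<Sum>r\<in>#M. degree r)"
proof -
  have "lead_coeff (\<Prod>\<^sub># M) = 1 \<and> degree (\<Prod>\<^sub># M) = (\<Sum>r\<in>#M. degree r)"
    using assms
  proof (induction M)
    case (add r M)
    then have IH: "lead_coeff (\<Prod>\<^sub># M) = 1" "degree (\<Prod>\<^sub># M) = (\<Sum>r\<in>#M. degree r)"
      and r: "lead_coeff r = 1" by auto
    have nz: "\<Prod>\<^sub># M \<noteq> 0" "r \<noteq> 0" using IH(1) r by (metis leading_coeff_0_iff zero_neq_one)+
    have "lead_coeff (r * \<Prod>\<^sub># M) = 1" unfolding lead_coeff_mult IH(1) r by simp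
    moreover have "degree (r * \<Prod>\<^sub># M) = degree r + degree (\<Prod>\<^sub># M)"
      using nz by (simp add: degree_mult_eq)
    ultimately show ?case using IH(2) by (simp only: image_mset_add_mset prod_mset.add_mset sum_mset.add_mset)
  qed simp
  then show "lead_coeff (\<Prod>\<^sub># M) = 1" "degree (\<Prod>\<^sub># M) = (\<Sum>r\<in>#M. degree r)" by auto
qed

section \<open>Ultrametric absolute values and the Gauss lemma\<close>

locale ultrametric_field =
  fixes v :: "'a::field \<Rightarrow> real"
  assumes absolute_value: "absolute_value v"
    and ultrametric: "v (x + y) \<le> max (v x) (v y)"
begin

lemma nonneg [simp]: "0 \<le> v x"
  and eq_0_iff [simp]: "v x = 0 \<longleftrightarrow> x = 0"
  and mult: "v (x * y) = v x * v y"
  using absolute_value by (auto simp: absolute_value_def)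

lemma zero [simp]: "v 0 = 0"
  using eq_0_iff by blast

lemma pos_iff [simp]: "0 < v x \<longleftrightarrow> x \<noteq> 0"
  using nonneg[of x] eq_0_iff[of x] by linarith

lemma one [simp]: "v 1 = 1"
  using mult[of 1 1] eq_0_iff[of 1] by simp

lemma minus [simp]: "v (- x) = v x"
proof -
  have "(v (- 1))\<^sup>2 = 1" using mult[of "-1" "-1"] by (simp add: power2_eq_square)
  then have "v (- 1) = 1" using nonneg[of "-1"] by (simp add: power2_eq_1_iff)
  then show ?thesis using mult[of "-1" x] by simp
qed

lemma power: "v (x ^ k) = v x ^ k"
  by (induction k) (auto simp: mult)

lemma add_eq_of_less:
  assumes "v y < v x"
  shows "v (x + y) = v x"
  using ultrametric[of x y] ultrametric[of "x + y" "- y"] assms by (auto simp: max_def split: if_splits)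

lemma sum_le:
  assumes "\<And>i. i \<in> I \<Longrightarrow> v (t i) \<le> b" "0 \<le> b"
  shows "v (sum t I) \<le> b"
  using assms
proof (induction I rule: infinite_finite_induct)
  case (insert i I)
  then show ?case using ultrametric[of "t i" "sum t I"] by fastforce
qed auto

lemma sum_less:
  assumes "\<And>i. i \<in> I \<Longrightarrow> v (t i) < b" "0 < b"
  shows "v (sum t I) < b"
  using assms
proof (induction I rule: infinite_finite_induct)
  case (insert i I)
  then show ?case using ultrametric[of "t i" "sum t I"] by fastforce
qed auto

text \<open>
  Otherwise the term of largest value would exceed all others strictly and could not be cancelled.
\<close>

lemma vanishing_sum_imp_equal_values:
  assumes "finite I" "sum t I = 0" "k \<in> I" "t k \<noteq> 0"
  shows "\<exists>i\<in>I. \<exists>j\<in>I. i \<noteq> j \<and> t i \<noteq> 0 \<and> v (t i) = v (t j)"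
proof (rule ccontr)
  assume contra: "\<not> ?thesis"
  have "Max ((\<lambda>i. v (t i)) ` I) \<in> (\<lambda>i. v (t i)) ` I"
    using assms(1,3) by (intro Max_in) auto
  then obtain i where i: "i \<in> I" "v (t i) = Max ((\<lambda>i. v (t i)) ` I)" by auto
  have max: "v (t j) \<le> v (t i)" if "j \<in> I" for j
    using that assms(1) i(2) by auto
  have "0 < v (t i)" using max[OF assms(3)] assms(4) pos_iff[of "t k"] by linarith
  moreover have "v (t j) < v (t i)" if "j \<in> I - {i}" for j
    using that contra max[of j] i(1) \<open>0 < v (t i)\<close> by force
  ultimately have "v (sum t (I - {i})) < v (t i)" by (intro sum_less) auto
  then have "v (t i + sum t (I - {i})) = v (t i)" by (rule add_eq_of_less)
  then show False
    using assms(1,2) i(1) \<open>0 < v (t i)\<close> by (simp add: sum.remove)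
qed

text \<open>
  The strict inequality for \<open>i > s\<close> makes \<open>s\<close> unique and, as values are nonnegative, also forces the
  maximum to be positive if \<open>R > 0\<close>; so the zero sequence has no last dominant index.
\<close>

definition last_dominant :: "real \<Rightarrow> (nat \<Rightarrow> 'a) \<Rightarrow> nat \<Rightarrow> bool" where
  "last_dominant R c s \<longleftrightarrow>
     (\<forall>i. v (c i) * R ^ i \<le> v (c s) * R ^ s) \<and> (\<forall>i>s. v (c i) * R ^ i < v (c s) * R ^ s)"

lemma last_dominant_unique:
  assumes "last_dominant R c s" "last_dominant R c t"
  shows "s = t"
  using assms unfolding last_dominant_def by (metis linorder_neqE_nat not_le)

lemma last_dominant_pos:
  assumes "last_dominant R c s" "0 < R"
  shows "0 < v (c s) * R ^ s"
proof -
  have "0 \<le> v (c (Suc s)) * R ^ Suc s" using assms(2) by simp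
  also have "\<dots> < v (c s) * R ^ s" using assms(1) unfolding last_dominant_def by blast
  finally show ?thesis .
qed

lemma last_dominant_exists:
  assumes lim: "(\<lambda>i. v (c i) * R ^ i) \<longlonglongrightarrow> 0" and "c k \<noteq> 0" "0 < R"
  shows "\<exists>s. last_dominant R c s"
proof -
  define a where "a = (\<lambda>i. v (c i) * R ^ i)"
  \<comment> \<open>The tail lies strictly below \<open>a k\<close>, so only finitely many indices compete for the maximum.\<close>
  have "0 < a k" using assms(2,3) by (simp add: a_def)
  with lim have "eventually (\<lambda>i. a i < a k) sequentially"
    unfolding a_def by (rule order_tendstoD(2))
  then obtain N where N: "\<And>i. i \<ge> N \<Longrightarrow> a i < a k"
    by (auto simp: eventually_sequentially)
  have "k \<in> {..N}" using N[of k] by (cases "k \<le> N") auto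
  define m where "m = Max (a ` {..N})"
  have "m \<in> a ` {..N}" unfolding m_def by (intro Max_in) auto
  have m: "a i \<le> m" if "i \<le> N" for i using that unfolding m_def by simp
  have m': "a i \<le> m" for i
    using m[of i] m[of k] N[of i] \<open>k \<in> {..N}\<close> by (cases "i \<le> N") auto
  define s where "s = Max {i. i \<le> N \<and> a i = m}"
  have "s \<in> {i. i \<le> N \<and> a i = m}"
    unfolding s_def using \<open>m \<in> a ` {..N}\<close> by (intro Max_in) auto
  then have s: "s \<le> N" "a s = m" by auto
  have "a i < m" if "i > s" for i
  proof (cases "i \<le> N")
    case True
    have "a i \<noteq> m"
    proof
      assume "a i = m"
      then have "i \<le> s" unfolding s_def using True by (intro Max_ge) auto
      with that show False by simp
    qed
    then show ?thesis using m'[of i] by simp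
  next
    case False
    then show ?thesis using N[of i] m'[of k] by simp
  qed
  with m' s show ?thesis unfolding last_dominant_def a_def by blast
qed

lemma last_dominant_poly_exists:
  assumes "g \<noteq> 0" "0 < R"
  shows "\<exists>s. last_dominant R (coeff g) s"
proof (rule last_dominant_exists)
  have "eventually (\<lambda>i. v (coeff g i) * R ^ i = 0) sequentially"
    using eventually_gt_at_top[of "degree g"] by eventually_elim (simp add: coeff_eq_0)
  then show "(\<lambda>i. v (coeff g i) * R ^ i) \<longlonglongrightarrow> 0" by (rule tendsto_eventually)
  show "coeff g (degree g) \<noteq> 0" using assms(1) by simp
qed fact

text \<open>
  Gauss's lemma. Every product \<open>g\<^sub>i h\<^sub>j\<close>, weighted by \<open>R\<^bsup>i + j\<^esup>\<close>, is at most the product of the two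
  maxima, and it is strictly smaller if \<open>i > s\<close> or \<open>j > t\<close>. In the coefficient of index \<open>s + t\<close> the
  term \<open>g\<^sub>s h\<^sub>t\<close> is the only one without this property, so by the ultrametric inequality it alone
  determines the value; beyond \<open>s + t\<close> every term has it.
\<close>

lemma last_dominant_mult:
  assumes g: "last_dominant R (coeff g) s" and h: "last_dominant R (coeff h) t" and R: "0 < R"
  shows "last_dominant R (coeff (g * h)) (s + t)"
    and "v (coeff (g * h) (s + t)) = v (coeff g s) * v (coeff h t)"
proof -
  define A where "A = (\<lambda>i. v (coeff g i) * R ^ i)"
  define B where "B = (\<lambda>i. v (coeff h i) * R ^ i)"
  have pos: "0 < A s" "0 < B t" using last_dominant_pos[OF _ R] g h by (auto simp: A_def B_def)
  have nn: "0 \<le> A i" "0 \<le> B i" for i using R by (auto simp: A_def B_def)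
  have le: "A i \<le> A s" "B i \<le> B t" for i
    using g h by (auto simp: last_dominant_def A_def B_def)
  have less: "i > s \<Longrightarrow> A i < A s" "i > t \<Longrightarrow> B i < B t" for i
    using g h by (auto simp: last_dominant_def A_def B_def)
  have AB_le: "A i * B j \<le> A s * B t" for i j
    using le nn pos by (intro mult_mono) (auto intro: less_imp_le)
  have AB_less: "A i * B j < A s * B t" if "i > s \<or> j > t" for i j
    using that
  proof
    assume "i > s"
    have "A i * B j \<le> A i * B t" using nn le by (intro mult_left_mono)
    also have "\<dots> < A s * B t" using less(1)[OF \<open>i > s\<close>] pos by simp
    finally show ?thesis .
  next
    assume "j > t"
    have "A i * B j \<le> A s * B j" using nn le by (intro mult_right_mono)
    also have "\<dots> < A s * B t" using less(2)[OF \<open>j > t\<close>] pos by simp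
    finally show ?thesis .
  qed
  have v_term: "v (coeff g i * coeff h (k - i)) = A i * B (k - i) / R ^ k" if "i \<le> k" for i k
  proof -
    have "R ^ k = R ^ i * R ^ (k - i)" using that by (simp flip: power_add)
    then show ?thesis using R by (simp add: A_def B_def mult)
  qed
  have bound_le: "v (coeff (g * h) k) * R ^ k \<le> A s * B t" for k
  proof -
    have "v (coeff (g * h) k) \<le> A s * B t / R ^ k"
      unfolding coeff_mult using R AB_le pos
      by (intro sum_le) (auto simp: v_term divide_right_mono less_imp_le)
    then show ?thesis using R by (simp add: pos_le_divide_eq)
  qed
  have bound_less: "v (coeff (g * h) k) * R ^ k < A s * B t" if "k > s + t" for k
  proof -
    have "v (coeff (g * h) k) < A s * B t / R ^ k"
      unfolding coeff_mult
    proof (intro sum_less)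
      fix i assume "i \<in> {..k}"
      moreover have "i > s \<or> k - i > t" using that by auto
      ultimately show "v (coeff g i * coeff h (k - i)) < A s * B t / R ^ k"
        using R AB_less by (simp add: v_term divide_strict_right_mono)
    qed (use R pos in simp)
    then show ?thesis using R by (simp add: pos_less_divide_eq)
  qed
  have main: "v (coeff (g * h) (s + t)) = v (coeff g s * coeff h t)"
  proof -
    let ?T = "\<lambda>i. coeff g i * coeff h (s + t - i)"
    have T: "v (?T s) = A s * B t / R ^ (s + t)" using v_term[of s "s + t"] by simp
    have "v (sum ?T ({..s + t} - {s})) < v (?T s)"
      unfolding T
    proof (intro sum_less)
      fix i assume i: "i \<in> {..s + t} - {s}"
      then have "i > s \<or> s + t - i > t" by auto
      with i show "v (?T i) < A s * B t / R ^ (s + t)"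
        using R AB_less by (simp add: v_term divide_strict_right_mono)
    qed (use R pos in simp)
    then have "v (?T s + sum ?T ({..s + t} - {s})) = v (?T s)" by (rule add_eq_of_less)
    moreover have "coeff (g * h) (s + t) = ?T s + sum ?T ({..s + t} - {s})"
      unfolding coeff_mult by (subst sum.remove[of _ s]) auto
    ultimately show ?thesis by simp
  qed
  then show "v (coeff (g * h) (s + t)) = v (coeff g s) * v (coeff h t)" by (simp add: mult)
  then have "v (coeff (g * h) (s + t)) * R ^ (s + t) = A s * B t"
    by (simp add: A_def B_def power_add)
  with bound_le bound_less show "last_dominant R (coeff (g * h)) (s + t)"
    by (simp add: last_dominant_def)
qed

lemma last_dominant_prod_mset:
  assumes "\<forall>q\<in>#M. last_dominant R (coeff q) (s q)" "0 < R"
  shows "last_dominant R (coeff (\<Prod>\<^sub># M)) (\<Sum>q\<in>#M. s q) \<and>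
         v (coeff (\<Prod>\<^sub># M) (\<Sum>q\<in>#M. s q)) = (\<Prod>q\<in>#M. v (coeff q (s q)))"
  using assms(1)
proof (induction M)
  case empty
  then show ?case using assms(2) by (auto simp: last_dominant_def)
next
  case (add q M)
  then show ?case
    using last_dominant_mult[of R q "s q" "\<Prod>\<^sub># M" "\<Sum>q\<in>#M. s q"] assms(2) by simp
qed

lemma last_dominant_smult:
  assumes "last_dominant R (coeff g) s" "c \<noteq> 0"
  shows "last_dominant R (coeff (smult c g)) s"
  using assms by (simp add: last_dominant_def mult mult.assoc)

end

section \<open>The absolute value of a finite extension of the p-adic numbers\<close>

text \<open>
  A homogeneous linear system over \<open>F\<close> with more unknowns (\<open>I\<close>) than equations (\<open>B\<close>) has a nonzero
  solution. The induction eliminates one equation and one unknown at a time.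
\<close>

lemma linear_relation_exists:
  fixes c :: "'i \<Rightarrow> 'b \<Rightarrow> 'a::field"
  assumes F: "is_subfield F" and "finite B" and "finite I" "card I > card B"
    and "\<And>i b. i \<in> I \<Longrightarrow> b \<in> B \<Longrightarrow> c i b \<in> F"
  shows "\<exists>l. (\<forall>i\<in>I. l i \<in> F) \<and> (\<exists>i\<in>I. l i \<noteq> 0) \<and> (\<forall>b\<in>B. (\<Sum>i\<in>I. l i * c i b) = 0)"
  using assms(2-)
proof (induction B arbitrary: I c rule: finite_induct)
  case empty
  then have "I \<noteq> {}" by auto
  then show ?case using F by (intro exI[of _ "\<lambda>_. 1"]) (auto simp: is_subfield_def)
next
  case (insert b B)
  show ?case
  proof (cases "\<forall>i\<in>I. c i b = 0")
    case True
    have "card I > card B" using insert.prems(2) insert.hyps by simp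
    moreover have "c i b' \<in> F" if "i \<in> I" "b' \<in> B" for i b' using that insert.prems(3) by simp
    ultimately obtain l where "\<forall>i\<in>I. l i \<in> F" "\<exists>i\<in>I. l i \<noteq> 0" "\<forall>b\<in>B. (\<Sum>i\<in>I. l i * c i b) = 0"
      using insert.IH[of I c, OF insert.prems(1)] by auto
    with True show ?thesis by (intro exI[of _ l]) auto
  next
    case False
    then obtain j where j: "j \<in> I" "c j b \<noteq> 0" by blast
    \<comment> \<open>Solve equation \<open>b\<close> for the unknown \<open>j\<close> and substitute into the other equations.\<close>
    define c' where "c' = (\<lambda>i b'. c i b' - c i b / c j b * c j b')"
    have F_diff: "x - y \<in> F" if "x \<in> F" "y \<in> F" for x y
    proof -
      have "x + (- y) \<in> F" using F that unfolding is_subfield_def by blast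
      then show ?thesis by simp
    qed
    have F_div: "x / y \<in> F" if "x \<in> F" "y \<in> F" for x y
      using F that unfolding is_subfield_def divide_inverse by blast
    have F_mult: "x * y \<in> F" if "x \<in> F" "y \<in> F" for x y
      using F that unfolding is_subfield_def by blast
    have F_sum: "sum t A \<in> F" if "\<And>i. i \<in> A \<Longrightarrow> t i \<in> F" for t and A :: "'i set"
      using that F by (induction A rule: infinite_finite_induct) (auto simp: is_subfield_def)
    have "card (I - {j}) > card B" using insert.prems insert.hyps j by simp
    moreover have "c' i b' \<in> F" if "i \<in> I - {j}" "b' \<in> B" for i b'
      unfolding c'_def using that insert.prems(3) j(1) by (intro F_diff F_mult F_div) auto
    ultimately obtain l where
      l: "\<forall>i\<in>I - {j}. l i \<in> F" "\<exists>i\<in>I - {j}. l i \<noteq> 0" "\<forall>b'\<in>B. (\<Sum>i\<in>I - {j}. l i * c' i b') = 0"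
      using insert.IH[of "I - {j}" c'] insert.prems(1) by auto
    define lj where "lj = (\<Sum>i\<in>I - {j}. l i * (c i b / c j b))"
    define l' where "l' = (\<lambda>i. if i = j then - lj else l i)"
    have expand: "(\<Sum>i\<in>I. l' i * c i b') = (\<Sum>i\<in>I - {j}. l i * c' i b')" for b'
    proof -
      have "(\<Sum>i\<in>I. l' i * c i b') = - lj * c j b' + (\<Sum>i\<in>I - {j}. l' i * c i b')"
        using j(1) insert.prems(1) by (simp add: sum.remove l'_def)
      also have "(\<Sum>i\<in>I - {j}. l' i * c i b') = (\<Sum>i\<in>I - {j}. l i * c i b')"
        by (intro sum.cong) (auto simp: l'_def)
      also have "- lj * c j b' + \<dots> = (\<Sum>i\<in>I - {j}. l i * c' i b')"
        by (simp add: lj_def c'_def sum_distrib_right right_diff_distrib sum_subtractf mult.assoc)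
      finally show ?thesis .
    qed
    have "lj \<in> F"
      unfolding lj_def using l(1) insert.prems(3) j(1) by (intro F_sum F_mult F_div) auto
    then have "\<forall>i\<in>I. l' i \<in> F" using l(1) F by (auto simp: l'_def is_subfield_def)
    moreover have "\<exists>i\<in>I. l' i \<noteq> 0" using l(2) by (auto simp: l'_def)
    moreover have "c' i b = 0" for i using j(2) by (simp add: c'_def)
    then have "\<forall>b'\<in>insert b B. (\<Sum>i\<in>I. l' i * c i b') = 0" using l(3) by (simp add: expand)
    ultimately show ?thesis by blast
  qed
qed

text \<open>
  By the binomial formula, \<open>|x + y|\<^sup>k \<le> (k + 1) max(|x|, |y|)\<^sup>k\<close> for all \<open>k\<close>. If
  \<open>|x + y|\<close> exceeded the maximum, the left side would eventually outgrow the right side, since the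
  factor \<open>k + 1\<close> is only linear.
\<close>

lemma ultrametric_if_bounded_on_naturals:
  assumes abs: "absolute_value v" and le1: "\<And>k. v (of_nat k) \<le> 1"
  shows "ultrametric_field v"
proof
  have nonneg: "0 \<le> v x" and mult: "v (x * y) = v x * v y" and tri: "v (x + y) \<le> v x + v y"
    and eq0: "v x = 0 \<longleftrightarrow> x = 0" for x y
    using abs by (auto simp: absolute_value_def)
  have one: "v 1 = 1" using mult[of 1 1] eq0[of 1] by simp
  have power: "v (x ^ k) = v x ^ k" for x k by (induction k) (auto simp: mult one)
  have zero: "v 0 = 0" using eq0 by blast
  have sum: "v (sum t A) \<le> (\<Sum>i\<in>A. v (t i))" for t and A :: "nat set"
  proof (induction A rule: infinite_finite_induct)
    case (insert i A)
    then show ?case using tri[of "t i" "sum t A"] by simp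
  qed (auto simp: zero)
  fix x y
  show "v (x + y) \<le> max (v x) (v y)"
  proof (rule ccontr)
    define m where "m = max (v x) (v y)"
    assume "\<not> v (x + y) \<le> max (v x) (v y)"
    then have less: "m < v (x + y)" unfolding m_def by (simp only: not_le)
    have m: "v x \<le> m" "v y \<le> m" "0 \<le> m" using nonneg[of x] by (auto simp: m_def)
    have bound: "v (x + y) ^ k \<le> real (k + 1) * m ^ k" for k
    proof -
      have "v (x + y) ^ k = v (\<Sum>i\<le>k. of_nat (k choose i) * x ^ i * y ^ (k - i))"
        by (simp add: binomial_ring flip: power)
      also have "\<dots> \<le> (\<Sum>i\<le>k. v (of_nat (k choose i) * x ^ i * y ^ (k - i)))" by (rule sum)
      also have "\<dots> \<le> (\<Sum>i\<le>k. m ^ k)"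
      proof (intro sum_mono)
        fix i assume "i \<in> {..k}"
        have "v (of_nat (k choose i) * x ^ i * y ^ (k - i)) \<le> 1 * m ^ i * m ^ (k - i)"
          unfolding mult power using le1 nonneg m by (intro mult_mono power_mono) auto
        with \<open>i \<in> {..k}\<close> show "v (of_nat (k choose i) * x ^ i * y ^ (k - i)) \<le> m ^ k"
          by (simp flip: power_add)
      qed
      finally show ?thesis by simp
    qed
    define r where "r = m / v (x + y)"
    have pos: "0 < v (x + y)" using less m(3) by simp
    have r: "0 \<le> r" "r < 1" using less m(3) pos by (auto simp: r_def)
    have "1 \<le> real (k + 1) * r ^ k" for k
      using bound[of k] pos by (simp add: r_def power_divide field_simps)
    moreover have "(\<lambda>k. real k * r ^ k + r ^ k) \<longlonglongrightarrow> 0 + 0"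
      using r by (intro tendsto_add powser_times_n_limit_0 LIMSEQ_power_zero) auto
    then have "(\<lambda>k. real (k + 1) * r ^ k) \<longlonglongrightarrow> 0" by (simp add: algebra_simps)
    ultimately have "(1::real) \<le> 0" by (intro LIMSEQ_le_const) auto
    then show False by simp
  qed
qed fact

lemma padic_abs_rat_of_nat_le_1: 
  assumes "prime p"
  shows "padic_abs_rat p (of_nat k) \<le> 1"
proof (cases "k = 0")
  case False
  have "real p > 1" using assms prime_gt_1_nat by simp
  have "quotient_of (rat_of_nat k) = (int k, 1)"
    using quotient_of_rat_of_int[of "int k"] by simp
  with False have "padic_abs_rat p (of_nat k) = real p powi (- int (multiplicity (int p) (int k)))"
    by (simp add: padic_abs_rat_def padic_valuation_rat_def)
  also have "\<dots> \<le> real p powi 0"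
    using \<open>real p > 1\<close> by (intro power_int_increasing) auto
  finally show ?thesis by simp
qed (simp add: padic_abs_rat_def)

lemma padic_field_ultrametric:
  fixes v :: "'a::field_char_0 \<Rightarrow> real"
  assumes "prime p" "finite_extension_padic p v"
  shows "ultrametric_field v"
proof (rule ultrametric_if_bounded_on_naturals)
  fix k
  from assms(2) obtain F where "is_padic_numbers p v F"
    by (auto simp: finite_extension_padic_def)
  then have "v (of_rat (of_nat k)) = padic_abs_rat p (of_nat k)"
    unfolding is_padic_numbers_def by blast
  then show "v (of_nat k) \<le> 1" using padic_abs_rat_of_nat_le_1[OF assms(1), of k] by simp
qed (use assms(2) in \<open>simp add: finite_extension_padic_def\<close>)

text \<open>
  A rational number closer to \<open>x\<close> than \<open>|x|\<close> has the same absolute value as \<open>x\<close>.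
\<close>

lemma padic_numbers_value_group:
  fixes v :: "'a::field_char_0 \<Rightarrow> real"
  assumes "ultrametric_field v" "is_padic_numbers p v F" "x \<in> F" "x \<noteq> 0"
  shows "\<exists>z. v x = real p powi z"
proof -
  interpret ultrametric_field v by fact
  have "0 < v x" using assms(4) by simp
  then obtain r where r: "v (x - of_rat r) < v x"
    using assms(2,3) unfolding is_padic_numbers_def by blast
  have "v (x + - (x - of_rat r)) = v x" by (intro add_eq_of_less) (use r in \<open>simp only: minus\<close>)
  then have vr: "v x = v (of_rat r)" by simp
  also have "\<dots> = padic_abs_rat p r" using assms(2) unfolding is_padic_numbers_def by blast
  finally show ?thesis using assms(4) vr by (auto simp: padic_abs_rat_def)
qed

text \<open>
  If the extension is spanned by \<open>m\<close> elements, then \<open>1, x, \<dots>, x\<^sup>m\<close> satisfy a linear relation over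
  the p-adic numbers. Two of its terms \<open>l\<^sub>i x\<^sup>i\<close> and \<open>l\<^sub>j x\<^sup>j\<close> with \<open>i < j\<close> have the same nonzero
  absolute value, so \<open>|x|\<^bsup>j - i\<^esup>\<close> is a power of \<open>p\<close>. Since \<open>j - i\<close> divides \<open>m!\<close>, the exponent
  \<open>m!\<close> serves for all \<open>x\<close>.
\<close>

lemma finite_extension_value_group:
  fixes v :: "'a::field_char_0 \<Rightarrow> real"
  assumes "prime p" "finite_extension_padic p v"
  shows "\<exists>m>0. \<forall>x. x \<noteq> 0 \<longrightarrow> (\<exists>z. v x ^ m = real p powi z)"
proof -
  interpret ultrametric_field v using assms by (rule padic_field_ultrametric)
  from assms(2) obtain F B where F: "is_padic_numbers p v F" and B: "finite B"
    and span: "\<And>x. \<exists>c. (\<forall>b\<in>B. c b \<in> F) \<and> x = (\<Sum>b\<in>B. c b * b)"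
    by (auto simp: finite_extension_padic_def finite_over_def)
  have subfield: "is_subfield F" using F by (simp add: is_padic_numbers_def)
  have p: "real p > 0" using assms(1) prime_gt_0_nat by simp
  have "\<exists>z. v x ^ fact (card B) = real p powi z" if x: "x \<noteq> 0" for x
  proof -
    have "\<forall>i. \<exists>c. (\<forall>b\<in>B. c b \<in> F) \<and> x ^ i = (\<Sum>b\<in>B. c b * b)" using span by blast
    then obtain c where c: "\<And>i b. b \<in> B \<Longrightarrow> c i b \<in> F" "\<And>i. x ^ i = (\<Sum>b\<in>B. c i b * b)"
      by metis
    obtain l where l: "\<forall>i\<in>{..card B}. l i \<in> F" "\<exists>i\<in>{..card B}. l i \<noteq> 0"
      "\<forall>b\<in>B. (\<Sum>i\<le>card B. l i * c i b) = 0"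
      using linear_relation_exists[OF subfield B, of "{..card B}" c] c(1) by auto
    have "(\<Sum>i\<le>card B. l i * x ^ i) = (\<Sum>i\<le>card B. \<Sum>b\<in>B. l i * c i b * b)"
      by (simp add: c(2) sum_distrib_left mult.assoc)
    also have "\<dots> = (\<Sum>b\<in>B. (\<Sum>i\<le>card B. l i * c i b) * b)"
      by (subst sum.swap) (simp add: sum_distrib_right)
    also have "\<dots> = 0" using l(3) by simp
    finally have rel: "(\<Sum>i\<le>card B. l i * x ^ i) = 0" .
    obtain k where k: "k \<in> {..card B}" "l k * x ^ k \<noteq> 0" using l(2) x by auto
    from vanishing_sum_imp_equal_values[OF _ rel k] obtain i j
      where ij: "i \<le> card B" "j \<le> card B" "i \<noteq> j" "l i \<noteq> 0" "v (l i * x ^ i) = v (l j * x ^ j)"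
      by auto
    then have "l j \<noteq> 0" using x pos_iff[of "l i * x ^ i"] by auto
    have less: "\<exists>k z. 0 < k \<and> k \<le> card B \<and> v x ^ k = real p powi z"
      if "i < j" "j \<le> card B" and lnz: "l i \<noteq> 0" "l j \<noteq> 0" and "v (l i * x ^ i) = v (l j * x ^ j)" for i j
    proof -
      have "l i \<in> F" "l j \<in> F" using l(1) that by auto
      then obtain y z where yz: "v (l i) = real p powi y" "v (l j) = real p powi z"
        using padic_numbers_value_group[OF ultrametric_field_axioms F] lnz by blast
      have "x ^ j = x ^ i * x ^ (j - i)" using that(1) by (simp flip: power_add)
      then have "v (l i) * v (x ^ i) = v (l j) * v (x ^ (j - i)) * v (x ^ i)"
        using that(5) by (simp add: mult)
      then have "v (l i) = v (l j) * v x ^ (j - i)" using x by (simp add: power)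
      then have "v x ^ (j - i) = real p powi (y - z)"
        unfolding yz using p by (subst power_int_diff) (auto simp: eq_divide_eq mult.commute)
      then show ?thesis using that(1,2) by (intro exI[of _ "j - i"]) auto
    qed
    have "\<exists>k z. 0 < k \<and> k \<le> card B \<and> v x ^ k = real p powi z"
    proof (cases "i < j")
      case True
      then show ?thesis using less[of i j] ij \<open>l j \<noteq> 0\<close> by simp
    next
      case False
      then show ?thesis using less[of j i] ij \<open>l j \<noteq> 0\<close> by simp
    qed
    then obtain k z where kz: "0 < k" "k \<le> card B" "v x ^ k = real p powi z" by blast
    then have "k dvd fact (card B)" by (simp add: dvd_fact)
    then obtain h where "fact (card B) = k * h" by blast
    then have "v x ^ fact (card B) = real p powi (z * int h)"
      using kz(3) by (simp add: power_mult power_int_mult)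
    then show ?thesis by blast
  qed
  then show ?thesis by (intro exI[of _ "fact (card B)"]) simp
qed

lemma powers_bounded_away_from_above:
  fixes b y :: real
  assumes "1 < b" "0 < y"
  shows "\<exists>c>1. \<forall>z::int. y < b powi z \<longrightarrow> c * y \<le> b powi z"
proof -
  define z0 where "z0 = \<lfloor>log b y\<rfloor> + 1"
  have powi: "b powi z = b powr real_of_int z" for z using assms(1) by (simp add: powr_real_of_int')
  have less_iff: "y < b powi z \<longleftrightarrow> log b y < real_of_int z" for z
    unfolding powi using assms by (simp add: log_less_iff)
  have "y < b powi z0" unfolding less_iff z0_def by linarith
  moreover have "b powi z0 \<le> b powi z" if "y < b powi z" for z
  proof -
    have "z0 \<le> z" using that unfolding less_iff z0_def by linarith
    then show ?thesis using assms(1) by (intro power_int_increasing) auto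
  qed
  ultimately show ?thesis using assms(2) by (intro exI[of _ "b powi z0 / y"]) auto
qed

section \<open>Counting irreducible factors of small degree\<close>

context ultrametric_field
begin

text \<open>
  The excess is \<open>ln (|q\<^sub>s| / R\<^sup>i)\<close> with \<open>i = deg q - s \<le> d\<close>. For each of these finitely many \<open>i\<close>,
  the values \<open>|q\<^sub>s|\<^sup>m\<close> range over the powers of \<open>b\<close>, so those larger than \<open>R\<^bsup>i m\<^esup>\<close> stay away
  from it by a constant factor.
\<close>

lemma excess_bounded_below:
  assumes "1 < b" "0 < m" "0 < R"
    and value_group: "\<And>x. x \<noteq> 0 \<Longrightarrow> \<exists>z. v x ^ m = b powi z"
  shows "\<exists>\<kappa>>0. \<forall>q s. lead_coeff q = 1 \<longrightarrow> degree q \<le> d \<longrightarrow> last_dominant R (coeff q) s \<longrightarrow> s < degree q \<longrightarrow>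
           \<kappa> \<le> ln (v (coeff q s) * R ^ s / R ^ degree q)"
proof -
  have "\<exists>c>1. \<forall>z::int. (R ^ i) ^ m < b powi z \<longrightarrow> c * (R ^ i) ^ m \<le> b powi z" for i
    using assms(1,3) by (intro powers_bounded_away_from_above) auto
  then obtain c where c: "\<And>i. 1 < c i" 
    "\<And>i z. (R ^ i) ^ m < b powi z \<Longrightarrow> c i * (R ^ i) ^ m \<le> b powi z"
    by metis
  define e where "e = Min (c ` {..d})"
  have e: "1 < e" "e \<le> c i" if "i \<le> d" for i
    unfolding e_def using c(1) that by (auto simp: Min_gr_iff)
  have "ln e / real m \<le> ln (v (coeff q s) * R ^ s / R ^ degree q)"
    if q: "lead_coeff q = 1" "degree q \<le> d" "last_dominant R (coeff q) s" "s < degree q" for q s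
  proof -
    define i where "i = degree q - s"
    have R_split: "R ^ degree q = R ^ s * R ^ i"
      using q(4) by (simp add: i_def flip: power_add)
    have "v (coeff q (degree q)) * R ^ degree q < v (coeff q s) * R ^ s"
      using q(3,4) unfolding last_dominant_def by blast
    then have less: "R ^ i < v (coeff q s)"
      using q(1) assms(3) by (simp add: R_split mult.commute)
    have Ri: "0 < R ^ i" using assms(3) by simp
    with less have "coeff q s \<noteq> 0" using pos_iff[of "coeff q s"] by linarith
    then obtain z where z: "v (coeff q s) ^ m = b powi z" using value_group by blast
    have "(R ^ i) ^ m < b powi z"
      unfolding z[symmetric] using less Ri assms(2) by (intro power_strict_mono) auto
    then have "c i * (R ^ i) ^ m \<le> v (coeff q s) ^ m" unfolding z by (rule c(2))
    moreover have "i \<le> d" using q(2) by (simp add: i_def)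
    then have "e * (R ^ i) ^ m \<le> c i * (R ^ i) ^ m" using e(2) Ri by (intro mult_right_mono) auto
    ultimately have "e * (R ^ i) ^ m \<le> v (coeff q s) ^ m" by linarith
    then have "e \<le> (v (coeff q s) / R ^ i) ^ m"
      using Ri by (simp add: power_divide pos_le_divide_eq)
    then have "ln e \<le> ln ((v (coeff q s) / R ^ i) ^ m)"
      using e(1)[of 0] by simp
    also have "\<dots> = real m * ln (v (coeff q s) / R ^ i)"
      by (rule ln_realpow)
    finally show ?thesis using assms(2,3) by (simp add: R_split pos_divide_le_eq mult.commute)
  qed
  moreover have "0 < ln e / real m" using e(1)[of 0] assms(2) by simp
  ultimately show ?thesis by blast
qed

text \<open>
  For a monic irreducible factor \<open>q\<close> with last dominant index \<open>s\<close> and excess \<open>e\<close>, the number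
  \<open>s + e / \<kappa>\<close> is nonnegative, and it is at least \<open>1\<close> if \<open>deg q \<le> d\<close>. Summed over all factors
  with multiplicity it yields the right-hand side, by Gauss's lemma.
\<close>

lemma count_irreducible_factors_le_bound:
  assumes "g \<noteq> 0" "0 < R" "last_dominant R (coeff g) N" "0 < \<kappa>"
    and gap: "\<And>q s. lead_coeff q = 1 \<Longrightarrow> degree q \<le> d \<Longrightarrow> last_dominant R (coeff q) s \<Longrightarrow> s < degree q \<Longrightarrow>
           \<kappa> \<le> ln (v (coeff q s) * R ^ s / R ^ degree q)"
  shows "real (count_irreducible_factors_le g d) \<le>
           real N + (ln (v (coeff g N) * R ^ N) - ln (v (lead_coeff g) * R ^ degree g)) / \<kappa>"
proof -
  obtain M c where M: "\<forall>q\<in>#M. irreducible q \<and> lead_coeff q = 1"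
    and c: "c \<noteq> 0" and g: "g = smult c (\<Prod>\<^sub># M)"
    using monic_irreducible_factorization_exists[OF assms(1)] by blast
  have "\<forall>q\<in>#M. \<exists>s. last_dominant R (coeff q) s"
    using M last_dominant_poly_exists[OF _ assms(2)] by (metis not_irreducible_zero)
  then obtain s where s: "\<forall>q\<in>#M. last_dominant R (coeff q) (s q)" by metis
  \<comment> \<open>The logarithm of \<open>w q\<close> is the excess of \<open>q\<close>.\<close>
  define w where "w = (\<lambda>q. v (coeff q (s q)) * R ^ s q / R ^ degree q)"
  have prod: "last_dominant R (coeff (\<Prod>\<^sub># M)) (\<Sum>q\<in>#M. s q)"
    "v (coeff (\<Prod>\<^sub># M) (\<Sum>q\<in>#M. s q)) = (\<Prod>q\<in>#M. v (coeff q (s q)))"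
    using last_dominant_prod_mset[OF s assms(2)] by auto
  have N: "N = (\<Sum>q\<in>#M. s q)"
    using last_dominant_unique[OF assms(3)] last_dominant_smult[OF prod(1) c] g by simp
  have monic: "\<forall>q\<in>#M. lead_coeff q = 1" using M by simp
  have lc: "lead_coeff g = c" and deg: "degree g = (\<Sum>q\<in>#M. degree q)"
    using degree_prod_mset_monic[OF monic] c by (auto simp: g lead_coeff_smult)
  have w_ge: "1 \<le> w q" if "q \<in># M" for q
  proof -
    have "v (coeff q (degree q)) * R ^ degree q \<le> v (coeff q (s q)) * R ^ s q"
      using s that unfolding last_dominant_def by blast
    then show ?thesis using monic that assms(2) by (simp add: w_def)
  qed
  have powers: "(\<Prod>q\<in>#M. R ^ h q) = R ^ (\<Sum>q\<in>#M. h q)" for h :: "'a poly \<Rightarrow> nat"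
    by (induction M) (auto simp: power_add)
  have "(\<Prod>q\<in>#M. w q) * R ^ degree g = (\<Prod>q\<in>#M. v (coeff q (s q))) * R ^ N"
  proof -
    have "(\<Prod>q\<in>#M. w q) * (\<Prod>q\<in>#M. R ^ degree q) = (\<Prod>q\<in>#M. v (coeff q (s q))) * (\<Prod>q\<in>#M. R ^ s q)"
      unfolding prod_mset.distrib[symmetric] using assms(2) by (simp add: w_def)
    then show ?thesis by (simp add: powers deg N)
  qed
  then have w_prod: "(\<Prod>q\<in>#M. w q) * (v (lead_coeff g) * R ^ degree g) = v (coeff g N) * R ^ N"
    using prod(2) unfolding lc by (simp add: g N mult)
  have w_prod_pos: "0 < (\<Prod>q\<in>#M. w q)" "ln (\<Prod>q\<in>#M. w q) = (\<Sum>q\<in>#M. ln (w q))"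
  proof -
    have "0 < (\<Prod>q\<in>#M. w q) \<and> ln (\<Prod>q\<in>#M. w q) = (\<Sum>q\<in>#M. ln (w q))"
      using w_ge
    proof (induction M)
      case (add q M)
      then have "0 < w q" "0 < (\<Prod>q\<in>#M. w q)" "ln (\<Prod>q\<in>#M. w q) = (\<Sum>q\<in>#M. ln (w q))"
        by (fastforce intro: less_le_trans[OF zero_less_one])+
      then show ?case by (simp add: ln_mult del: prod_mset_zero_iff)
    qed simp
    then show "0 < (\<Prod>q\<in>#M. w q)" "ln (\<Prod>q\<in>#M. w q) = (\<Sum>q\<in>#M. ln (w q))" by auto
  qed
  have "0 < v (lead_coeff g) * R ^ degree g" using assms(1,2) by simp
  then have ln_sum: "(\<Sum>q\<in>#M. ln (w q)) = ln (v (coeff g N) * R ^ N) - ln (v (lead_coeff g) * R ^ degree g)"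
    using w_prod_pos(1) unfolding w_prod[symmetric] w_prod_pos(2)[symmetric]
    by (simp only: ln_mult_pos)
  have each: "(if degree q \<le> d then 1 else 0) \<le> real (s q) + ln (w q) / \<kappa>" if q: "q \<in># M" for q
  proof -
    have nn: "0 \<le> ln (w q) / \<kappa>" using w_ge[OF q] assms(4) by simp
    show ?thesis
    proof (cases "degree q \<le> d \<and> s q < degree q")
      case True
      then have "\<kappa> \<le> ln (w q)"
        unfolding w_def using gap[of q "s q"] s monic q by blast
      then have "1 \<le> ln (w q) / \<kappa>" using assms(4) by simp
      then show ?thesis by simp
    next
      case False
      \<comment> \<open>If \<open>deg q \<le> d\<close>, the last dominant index is \<open>deg q\<close>, which is positive by irreducibility.\<close>
      have "\<not> is_unit q" "q \<noteq> 0" using M q by (auto simp: irreducible_def)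
      then have "0 < degree q" by (simp add: is_unit_iff_degree)
      with False have "degree q \<le> d \<Longrightarrow> 1 \<le> s q" by auto
      then show ?thesis using nn by auto
    qed
  qed
  have "real (count_irreducible_factors_le g d) = (\<Sum>q\<in>#M. if degree q \<le> d then 1 else 0)"
    unfolding count_irreducible_factors_le_eq_size[OF M c g]
    by (induction M) auto
  also have "\<dots> \<le> (\<Sum>q\<in>#M. real (s q) + ln (w q) / \<kappa>)" using each by (rule sum_mset_mono)
  also have "\<dots> = real N + (\<Sum>q\<in>#M. ln (w q)) / \<kappa>"
    unfolding N by (induction M) (auto simp: add_divide_distrib)
  finally show ?thesis unfolding ln_sum .
qed

end

lemma degree_le_max_degree_times_count:
  fixes g :: "'a::field poly"
  assumes "g \<noteq> 0" "max_irreducible_factor_degree g \<le> D"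
  shows "degree g \<le> D * count_irreducible_factors_le g D"
proof -
  obtain M c where M: "\<forall>q\<in>#M. irreducible q \<and> lead_coeff q = 1"
    and c: "c \<noteq> 0" and g: "g = smult c (\<Prod>\<^sub># M)"
    using monic_irreducible_factorization_exists[OF assms(1)] by blast
  have le: "degree q \<le> D" if "q \<in># M" for q
  proof -
    have "degree q \<le> max_irreducible_factor_degree g"
      unfolding max_irreducible_factor_degree_def irreducible_factors_eq_set_mset[OF M c g]
      using that by (intro Max_ge) auto
    with assms(2) show ?thesis by simp
  qed
  have "degree g = (\<Sum>q\<in>#M. degree q)"
    using degree_prod_mset_monic(2)[of M] M c by (simp add: g)
  also have "\<dots> \<le> (\<Sum>q\<in>#M. D)" using le by (rule sum_mset_mono)
  also have "\<dots> = D * size M" by simp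
  also have "size M = count_irreducible_factors_le g D"
    unfolding count_irreducible_factors_le_eq_size[OF M c g] using le
    by (metis filter_mset_True filter_mset_cong)
  finally show ?thesis .
qed

lemma coeff_partial_sum_poly: "coeff (partial_sum_poly f n) i = (if i \<le> n then fps_nth f i else 0)"
  by (auto simp: partial_sum_poly_def coeff_sum sum.delta)

lemma degree_partial_sum_poly:
  assumes "fps_nth f n \<noteq> 0"
  shows "degree (partial_sum_poly f n) = n" "partial_sum_poly f n \<noteq> 0"
proof -
  show "degree (partial_sum_poly f n) = n"
    using assms by (intro antisym degree_le le_degree) (auto simp: coeff_partial_sum_poly)
  show "partial_sum_poly f n \<noteq> 0" using assms coeff_partial_sum_poly[of f n n] by auto
qed

theorem theorem3p6:
  fixes p :: nat
    and v :: "'a::field_char_0 \<Rightarrow> real"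
    and f :: "'a fps"
    and R :: real
    and n :: "nat \<Rightarrow> nat"
  assumes "prime p"
    and "finite_extension_padic p v"
    and "ereal R = radius_of_convergence v f"
    and "0 < R"
    and "f \<in> tate_algebra v R"
    and "strict_mono n"
    and "(\<lambda>k. root (n k) (v (fps_nth f (n k)))) \<longlonglongrightarrow> 1 / R"
  shows "(\<forall>d>0. (\<lambda>k. real (count_irreducible_factors_le (partial_sum_poly f (n k)) d))
                  \<in> o(\<lambda>k. real (n k)))
       \<and> filterlim (\<lambda>k. max_irreducible_factor_degree (partial_sum_poly f (n k)))
           at_top sequentially"
proof -
  interpret ultrametric_field v using assms(1,2) by (rule padic_field_ultrametric)
  let ?g = "\<lambda>k. partial_sum_poly f (n k)"
  let ?\<rho> = "\<lambda>k. root (n k) (v (fps_nth f (n k)))"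
  have n_lim: "filterlim n at_top sequentially" using assms(6) by (rule filterlim_subseq)
  then have n_lim': "filterlim (\<lambda>k. real (n k)) at_top sequentially"
    by (rule filterlim_compose[OF filterlim_real_sequentially])
  have "eventually (\<lambda>k. 0 < ?\<rho> k) sequentially"
    using assms(4) by (intro order_tendstoD(1)[OF assms(7)]) simp
  then have good: "eventually (\<lambda>k. 0 < n k \<and> 0 < ?\<rho> k \<and> fps_nth f (n k) \<noteq> 0) sequentially"
    using filterlim_at_top[THEN iffD1, OF n_lim, rule_format, of 1]
    by eventually_elim auto
  then obtain k0 where "fps_nth f (n k0) \<noteq> 0" by (auto simp: eventually_sequentially)
  then obtain N where N: "last_dominant R (fps_nth f) N"
    using last_dominant_exists[of "fps_nth f"] assms(4,5) by (auto simp: tate_algebra_def)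
  define C where "C = ln (v (fps_nth f N) * R ^ N)"
  have o: "(\<lambda>k. real (count_irreducible_factors_le (?g k) d)) \<in> o(\<lambda>k. real (n k))" for d
  proof -
    obtain m where m: "0 < m" "\<And>x. x \<noteq> 0 \<Longrightarrow> \<exists>z. v x ^ m = real p powi z"
      using finite_extension_value_group[OF assms(1,2)] by blast
    have "1 < real p" using assms(1) prime_gt_1_nat by simp
    from excess_bounded_below[OF this m(1) assms(4) m(2)] obtain \<kappa> where \<kappa>: "0 < \<kappa>"
      "\<And>q s. lead_coeff q = 1 \<Longrightarrow> degree q \<le> d \<Longrightarrow> last_dominant R (coeff q) s \<Longrightarrow> s < degree q \<Longrightarrow>
           \<kappa> \<le> ln (v (coeff q s) * R ^ s / R ^ degree q)"
      by blast
    let ?b = "\<lambda>k. real N / real (n k) + (C / real (n k) - ln (?\<rho> k * R)) / \<kappa>"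
    have "eventually (\<lambda>k. real (count_irreducible_factors_le (?g k) d) / real (n k) \<le> ?b k) sequentially"
      using good filterlim_at_top[THEN iffD1, OF n_lim, rule_format, of N]
    proof eventually_elim
      case (elim k)
      then have n: "0 < n k" and \<rho>: "0 < ?\<rho> k" and nz: "fps_nth f (n k) \<noteq> 0" and "N \<le> n k" by auto
      have dom: "last_dominant R (coeff (?g k)) N"
        using N \<open>N \<le> n k\<close> last_dominant_pos[OF N assms(4)]
        by (auto simp: last_dominant_def coeff_partial_sum_poly intro: less_imp_le)
      have "v (fps_nth f (n k)) * R ^ n k = (?\<rho> k * R) ^ n k"
        using n by (simp add: power_mult_distrib)
      also have "ln \<dots> = real (n k) * ln (?\<rho> k * R)"
        by (rule ln_realpow)
      finally have ln_lead: "ln (v (fps_nth f (n k)) * R ^ n k) = real (n k) * ln (?\<rho> k * R)" .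
      have "real (count_irreducible_factors_le (?g k) d) \<le>
              real N + (C - ln (v (fps_nth f (n k)) * R ^ n k)) / \<kappa>"
        using count_irreducible_factors_le_bound[OF degree_partial_sum_poly(2)[OF nz] assms(4) dom \<kappa>] \<open>N \<le> n k\<close>
        by (simp add: degree_partial_sum_poly(1)[OF nz] coeff_partial_sum_poly C_def)
      also have "\<dots> = ?b k * real (n k)"
        unfolding ln_lead using n \<kappa>(1) by (simp add: field_simps)
      finally show ?case using n by (simp add: pos_divide_le_eq)
    qed
    moreover have "(\<lambda>k. ?\<rho> k * R) \<longlonglongrightarrow> 1"
      using tendsto_mult[OF assms(7) tendsto_const[of R]] assms(4) by simp
    then have "(\<lambda>k. ln (?\<rho> k * R)) \<longlonglongrightarrow> ln 1" by (intro tendsto_ln) auto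
    moreover have "(\<lambda>k. x / real (n k)) \<longlonglongrightarrow> 0" for x
      by (intro tendsto_divide_0[OF tendsto_const] filterlim_at_top_imp_at_infinity n_lim')
    ultimately have bound: "eventually (\<lambda>k. real (count_irreducible_factors_le (?g k) d) / real (n k) \<le> ?b k) sequentially"
      and ln_lim: "(\<lambda>k. ln (?\<rho> k * R)) \<longlonglongrightarrow> 0" and inv_lim: "\<And>x. (\<lambda>k. x / real (n k)) \<longlonglongrightarrow> 0"
      by auto
    have "?b \<longlonglongrightarrow> 0 + (0 - 0) / \<kappa>"
      using \<kappa>(1) by (intro tendsto_intros inv_lim ln_lim) auto
    then have b_lim: "?b \<longlonglongrightarrow> 0" by simp
    have nonneg_quot: "eventually (\<lambda>k. 0 \<le> real (count_irreducible_factors_le (?g k) d) / real (n k)) sequentially"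
      by (intro always_eventually allI) simp
    have "(\<lambda>k. real (count_irreducible_factors_le (?g k) d) / real (n k)) \<longlonglongrightarrow> 0"
      by (rule tendsto_sandwich[OF nonneg_quot bound tendsto_const b_lim])
    moreover have "eventually (\<lambda>k. real (n k) \<noteq> 0) sequentially"
      using good by eventually_elim simp
    ultimately show ?thesis by (intro smalloI_tendsto) auto
  qed
  have "eventually (\<lambda>k. D < max_irreducible_factor_degree (?g k)) sequentially" for D
  proof -
    \<comment> \<open>The constant makes \<open>D\<close> times the count at most \<open>n k / 2\<close>; using \<open>Suc D\<close> covers \<open>D = 0\<close>.\<close>
    have "eventually (\<lambda>k. norm (real (count_irreducible_factors_le (?g k) D)) \<le> 1 / (2 * real (Suc D)) * norm (real (n k))) sequentially"
      using o by (intro landau_o.smallD) auto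
    with good show ?thesis
    proof eventually_elim
      case (elim k)
      have nz: "fps_nth f (n k) \<noteq> 0" using elim by simp
      show ?case
      proof (rule ccontr)
        assume "\<not> D < max_irreducible_factor_degree (?g k)"
        then have "n k \<le> D * count_irreducible_factors_le (?g k) D"
          using degree_le_max_degree_times_count[OF degree_partial_sum_poly(2)[OF nz], of D]
          by (simp add: degree_partial_sum_poly(1)[OF nz])
        also have "\<dots> \<le> Suc D * count_irreducible_factors_le (?g k) D" by simp
        finally have "real (n k) \<le> real (Suc D) * real (count_irreducible_factors_le (?g k) D)"
          by (simp only: of_nat_mult[symmetric] of_nat_le_iff)
        also have "\<dots> \<le> real (Suc D) * (1 / (2 * real (Suc D)) * real (n k))"
          using elim by (intro mult_left_mono) auto
        also have "\<dots> = real (n k) / 2" by (simp del: of_nat_Suc)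
        finally show False using elim by simp
      qed
    qed
  qed
  then have "eventually (\<lambda>k. D \<le> max_irreducible_factor_degree (?g k)) sequentially" for D
    by (rule eventually_mono) (rule less_imp_le)
  then have "filterlim (\<lambda>k. max_irreducible_factor_degree (?g k)) at_top sequentially"
    by (simp add: filterlim_at_top)
  with o show ?thesis by blast
qed

end
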